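(* Let $\{\mathcal{G}_j : j \in J\}$ be a Parseval HS-frame for $\mathbb{H}$ with respect to $\mathbb{K}$. Then for all $K \subset J$ and all $f \in \mathbb{H}$, \[ \sum_{j \in K}\Vert \mathcal{G}_j(f) \Vert_2^2 - \bigg\Vert \sum_{j \in K} \mathcal{G}_j^* \mathcal{G}_j f \bigg\Vert^2 = \sum_{j \in K^c}\Vert \mathcal{G}_j(f) \Vert_2^2 - \bigg\Vert \sum_{j \in K^c} \mathcal{G}_j^* \mathcal{G}_j f \bigg\Vert^2 . \]
   Context: $\mathbb{H}$ and $\mathbb{K}$ are complex Hilbert spaces, $J$ is a countable index set, and $K^c = J \setminus K$ for $K \subset J$. $C_2 \subseteq \mathcal{L}(\mathbb{K})$ denotes the Hilbert-Schmidt class of operators on $\mathbb{K}$, a Hilbert space with inner product $[T,S]_\tau = \tau(S^*T)$ ($\tau$ the usual trace) and norm $\Vert T\Vert_2 = [T,T]_\tau^{1/2}$. A family $\{\mathcal{G}_j : j \in J\}$ of bounded linear operators from $\mathbb{H}$ to $C_2 \subseteq \mathcal{L}(\mathbb{K})$ is a Hilbert-Schmidt frame (HS-frame) for $\mathbb{H}$ with respect to $\mathbb{K}$ if there are constants $A,B>0$ such that $A\Vert f\Vert^2 \le \sum_{j\in J}\Vert \mathcal{G}_j(f)\Vert_2^2 \le B\Vert f\Vert^2$ for all $f\in\mathbb{H}$. It is a Parseval HS-frame if this holds with $A=B=1$. $\mathcal{G}_j^*: C_2 \to \mathbb{H}$ is the adjoint of $\mathcal{G}_j$. Series in $\mathbb{H}$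 are understood as unconditionally convergent in norm. *)

theory Defs
  imports "HOL-Analysis.Analysis"
begin

section \<open>Complex Hilbert spaces\<close>

text \<open>
  A complex inner product space is given on top of its underlying real inner product space
  (real part of the complex inner product), so that norm, topology and infinite sums are those of
  the library. The complex inner product is linear in the first argument.
\<close>

class complex_inner = real_inner +
  fixes scaleC :: "complex \<Rightarrow> 'a \<Rightarrow> 'a" (infixr "*\<^sub>C" 75)
    and cinner :: "'a \<Rightarrow> 'a \<Rightarrow> complex"
  assumes scaleC_add_right: "c *\<^sub>C (x + y) = c *\<^sub>C x + c *\<^sub>C y"
    and scaleC_add_left: "(c + d) *\<^sub>C x = c *\<^sub>C x + d *\<^sub>C x"
    and scaleC_scaleC: "c *\<^sub>C d *\<^sub>C x = (c * d) *\<^sub>C x"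
    and scaleC_of_real: "complex_of_real r *\<^sub>C x = r *\<^sub>R x"
    and cinner_commute: "cinner x y = cnj (cinner y x)"
    and cinner_add_left: "cinner (x + y) z = cinner x z + cinner y z"
    and cinner_scaleC_left: "cinner (c *\<^sub>C x) y = c * cinner x y"
    and Re_cinner: "Re (cinner x y) = inner x y"

class complex_hilbert = complex_inner + complete_space

instantiation complex :: complex_hilbert
begin

definition scaleC_complex :: "complex \<Rightarrow> complex \<Rightarrow> complex" where
  "scaleC_complex c x = c * x"

definition cinner_complex :: "complex \<Rightarrow> complex \<Rightarrow> complex" where
  "cinner_complex x y = x * cnj y"

instance
  by standard
    (simp_all add: scaleC_complex_def cinner_complex_def inner_complex_def algebra_simps
      scaleR_conv_of_real)

end

lemma cinner_self: "cinner x x = complex_of_real ((norm x)\<^sup>2)"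
  for x :: "'a::complex_inner"
proof -
  have "Im (cinner x x) = 0"
    using cinner_commute[of x x] by (simp add: complex_eq_iff)
  then show ?thesis
    by (simp add: complex_eq_iff Re_cinner power2_norm_eq_inner)
qed

definition bounded_clinear :: "('a::complex_inner \<Rightarrow> 'b::complex_inner) \<Rightarrow> bool" where
  "bounded_clinear T \<longleftrightarrow> bounded_linear T \<and> (\<forall>c x. T (c *\<^sub>C x) = c *\<^sub>C T x)"

text \<open>For bounded \<open>T\<close> between Hilbert spaces the vector below exists by the Riesz theorem.\<close>

definition cadjoint :: "('a::complex_inner \<Rightarrow> 'b::complex_inner) \<Rightarrow> 'b \<Rightarrow> 'a" where
  "cadjoint T y = (THE z. \<forall>x. cinner (T x) y = cinner x z)"

definition orthonormal :: "'a::complex_inner set \<Rightarrow> bool" where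
  "orthonormal B \<longleftrightarrow> (\<forall>e\<in>B. \<forall>e'\<in>B. cinner e e' = (if e = e' then 1 else 0))"

text \<open>Completeness of an orthonormal system is expressed as maximality.\<close>

definition is_onb :: "'a::complex_inner set \<Rightarrow> bool" where
  "is_onb B \<longleftrightarrow> orthonormal B \<and> (\<forall>x. (\<forall>e\<in>B. cinner x e = 0) \<longrightarrow> x = 0)"

lemma ex_onb: "\<exists>B :: 'a::complex_inner set. is_onb B"
proof -
  have "\<exists>M\<in>Collect orthonormal. \<forall>X\<in>Collect orthonormal. M \<subseteq> X \<longrightarrow> X = (M :: 'a set)"
  proof (rule subset_Zorn')
    fix C :: "'a set set"
    assume "subset.chain (Collect orthonormal) C"
    then have C: "\<And>X. X \<in> C \<Longrightarrow> orthonormal X" "\<And>X Y. X \<in> C \<Longrightarrow> Y \<in> C \<Longrightarrow> X \<subseteq> Y \<or> Y \<subseteq> X"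
      by (auto simp: subset_chain_def)
    show "\<Union>C \<in> Collect orthonormal"
      unfolding orthonormal_def mem_Collect_eq
    proof (intro ballI)
      fix e e' assume "e \<in> \<Union>C" "e' \<in> \<Union>C"
      then obtain X where "X \<in> C" "e \<in> X" "e' \<in> X"
        using C(2) by blast
      then show "cinner e e' = (if e = e' then 1 else 0)"
        using C(1) unfolding orthonormal_def by blast
    qed
  qed
  then obtain M :: "'a set" where M: "orthonormal M" "\<And>X. orthonormal X \<Longrightarrow> M \<subseteq> X \<Longrightarrow> X = M"
    by auto
  have "x = 0" if x: "\<forall>e\<in>M. cinner x e = 0" for x
  proof (rule ccontr)
    assume "x \<noteq> 0"
    define u where "u = complex_of_real (1 / norm x) *\<^sub>C x"
    have "norm u = 1"
      using \<open>x \<noteq> 0\<close> by (simp add: u_def scaleC_of_real del: of_real_divide)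
    then have uu: "cinner u u = 1"
      by (simp add: cinner_self)
    have ue: "cinner u e = 0" if "e \<in> M" for e
      using x that by (simp add: u_def cinner_scaleC_left)
    have eu: "cinner e u = 0" if "e \<in> M" for e
      using ue[OF that] cinner_commute[of e u] by simp
    have "orthonormal (insert u M)"
      using M(1) uu ue eu unfolding orthonormal_def by auto
    then have "u \<in> M"
      using M(2)[of "insert u M"] by blast
    then show False
      using ue[of u] uu by simp
  qed
  then show ?thesis
    using M(1) unfolding is_onb_def by blast
qed


section \<open>The Hilbert--Schmidt class\<close>

text \<open>
  The trace and the condition of being Hilbert--Schmidt do not depend on the orthonormal basis,
  so one basis is fixed once and for all. The space need not be separable.
\<close>

definition some_onb :: "'a::complex_inner set" where
  "some_onb = (SOME B. is_onb B)"

lemma is_onb_some_onb: "is_onb some_onb"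
  unfolding some_onb_def by (rule someI_ex) (rule ex_onb)

definition trace_op :: "('k::complex_inner \<Rightarrow> 'k) \<Rightarrow> complex" where
  "trace_op T = (\<Sum>\<^sub>\<infinity>e\<in>some_onb. cinner (T e) e)"

definition hilbert_schmidt :: "('k::complex_inner \<Rightarrow> 'k) \<Rightarrow> bool" where
  "hilbert_schmidt T \<longleftrightarrow> bounded_clinear T \<and> (\<lambda>e. (norm (T e))\<^sup>2) summable_on some_onb"

definition hs_inner :: "('k::complex_inner \<Rightarrow> 'k) \<Rightarrow> ('k \<Rightarrow> 'k) \<Rightarrow> complex" where
  "hs_inner T S = trace_op (cadjoint S \<circ> T)"

definition hs_norm :: "('k::complex_inner \<Rightarrow> 'k) \<Rightarrow> real" where
  "hs_norm T = sqrt (Re (hs_inner T T))"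

text \<open>
  Bounded linear maps from a space \<open>'h\<close> into the Hilbert--Schmidt class of \<open>'k\<close>, and
  their adjoints with respect to \<open>hs_inner\<close>.
\<close>

definition bounded_hs_map :: "('h::complex_inner \<Rightarrow> 'k::complex_inner \<Rightarrow> 'k) \<Rightarrow> bool" where
  "bounded_hs_map G \<longleftrightarrow>
     (\<forall>f. hilbert_schmidt (G f)) \<and>
     (\<forall>f g. G (f + g) = (\<lambda>x. G f x + G g x)) \<and>
     (\<forall>c f. G (c *\<^sub>C f) = (\<lambda>x. c *\<^sub>C G f x)) \<and>
     (\<exists>M. \<forall>f. hs_norm (G f) \<le> M * norm f)"

definition hs_adjoint :: "('h::complex_inner \<Rightarrow> 'k::complex_inner \<Rightarrow> 'k) \<Rightarrow> ('k \<Rightarrow> 'k) \<Rightarrow> 'h" where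
  "hs_adjoint G T = (THE h. \<forall>f. hs_inner (G f) T = cinner f h)"


section \<open>Hilbert--Schmidt frames\<close>

definition hs_frame_with_bounds ::
  "real \<Rightarrow> real \<Rightarrow> 'j set \<Rightarrow> ('j \<Rightarrow> 'h::complex_hilbert \<Rightarrow> 'k::complex_hilbert \<Rightarrow> 'k) \<Rightarrow> bool" where
  "hs_frame_with_bounds A B J G \<longleftrightarrow>
     (\<forall>j\<in>J. bounded_hs_map (G j)) \<and>
     (\<forall>f. (\<lambda>j. (hs_norm (G j f))\<^sup>2) summable_on J \<and>
          A * (norm f)\<^sup>2 \<le> (\<Sum>\<^sub>\<infinity>j\<in>J. (hs_norm (G j f))\<^sup>2) \<and>
          (\<Sum>\<^sub>\<infinity>j\<in>J. (hs_norm (G j f))\<^sup>2) \<le> B * (norm f)\<^sup>2)"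

definition parseval_hs_frame ::
  "'j set \<Rightarrow> ('j \<Rightarrow> 'h::complex_hilbert \<Rightarrow> 'k::complex_hilbert \<Rightarrow> 'k) \<Rightarrow> bool" where
  "parseval_hs_frame J G \<longleftrightarrow> hs_frame_with_bounds 1 1 J G"

end

theory Submission
  imports Defs
begin

text \<open>
  The operators \<open>S\<^sub>j = G\<^sub>j\<^sup>* G\<^sub>j\<close> are positive, and the Parseval condition says that they sum weakly, hence
  strongly, to the identity. With \<open>u\<close> and \<open>v\<close> the sums of \<open>S\<^sub>j f\<close> over \<open>K\<close> and over its complement,
  \<open>f = u + v\<close>, so the two sides are \<open>\<langle>f, u\<rangle> - \<langle>u, u\<rangle> = \<langle>v, u\<rangle>\<close> and \<open>\<langle>f, v\<rangle> - \<langle>v, v\<rangle> = \<langle>u, v\<rangle>\<close>, whose real parts agree.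
\<close>

section \<open>Riesz representation and adjoints\<close>

text \<open>The representing vector is the minimiser of \<open>\<parallel>x\<parallel>\<^sup>2 - 2 \<phi> x\<close>.\<close>

lemma real_riesz:
  fixes \<phi> :: "'a::{real_inner,complete_space} \<Rightarrow> real"
  assumes "bounded_linear \<phi>"
  obtains z where "\<And>x. \<phi> x = inner x z"
proof -
  interpret bounded_linear \<phi> by fact
  define \<Phi> where "\<Phi> x = (norm x)\<^sup>2 - 2 * \<phi> x" for x
  define m where "m = Inf (range \<Phi>)"
  obtain M where M: "\<And>x. norm (\<phi> x) \<le> norm x * M"
    using bounded by blast
  have "\<Phi> x \<ge> - M\<^sup>2" for x
  proof -
    have "2 * \<phi> x \<le> 2 * (norm x * M)"
      using M[of x] by auto
    moreover have "0 \<le> (norm x - M)\<^sup>2" by simp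
    ultimately show ?thesis
      unfolding \<Phi>_def power2_diff by linarith
  qed
  then have bdd: "bdd_below (range \<Phi>)"
    by (auto intro!: bdd_belowI)
  have m_le: "m \<le> \<Phi> x" for x
    unfolding m_def by (rule cInf_lower) (use bdd in auto)
  have "\<exists>x. \<Phi> x < m + inverse (real (Suc n))" for n
  proof -
    have "Inf (range \<Phi>) < m + inverse (real (Suc n))"
      by (simp add: m_def)
    from cInf_lessD[OF _ this] show ?thesis by auto
  qed
  then obtain X where X: "\<And>n. \<Phi> (X n) < m + inverse (real (Suc n))"
    by metis
  \<comment> \<open>The linear part of \<open>\<Phi>\<close> cancels, leaving the parallelogram law.
    As the midpoint value is at least \<open>m\<close>, near-minimisers must be close to each
    other.\<close>
  have parallelogram: "(norm (x - y))\<^sup>2 = 2 * \<Phi> x + 2 * \<Phi> y - 4 * \<Phi> ((1/2) *\<^sub>R (x + y))" for x y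
    unfolding \<Phi>_def
    by (simp add: power2_norm_eq_inner scaleR add algebra_simps inner_commute)
  have "Cauchy X"
  proof (rule metric_CauchyI)
    fix e :: real assume "0 < e"
    \<comment> \<open>Two values below \<open>m + inverse (Suc N)\<close> give a squared distance
      below \<open>4 * inverse (Suc N)\<close>, hence the quarter.\<close>
    then obtain N where N: "inverse (real (Suc N)) < e\<^sup>2 / 4"
      using reals_Archimedean[of "e\<^sup>2 / 4"] by auto
    show "\<exists>M. \<forall>m\<ge>M. \<forall>n\<ge>M. dist (X m) (X n) < e"
    proof (intro exI allI impI)
      fix k n assume "N \<le> k" "N \<le> n"
      then have "inverse (real (Suc k)) \<le> inverse (real (Suc N))"
        "inverse (real (Suc n)) \<le> inverse (real (Suc N))"
        by (auto intro!: le_imp_inverse_le)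
      with X[of k] X[of n] N m_le[of "(1/2) *\<^sub>R (X k + X n)"]
      have "(norm (X k - X n))\<^sup>2 < e\<^sup>2"
        unfolding parallelogram by linarith
      with \<open>0 < e\<close> show "dist (X k) (X n) < e"
        by (simp add: dist_norm power2_less_imp_less)
    qed
  qed
  then obtain z where z: "X \<longlonglongrightarrow> z"
    using Cauchy_convergent convergent_def by blast
  have "(\<lambda>n. \<Phi> (X n)) \<longlonglongrightarrow> \<Phi> z"
    unfolding \<Phi>_def by (intro tendsto_intros tendsto z)
  moreover have "(\<lambda>n. m + inverse (real (Suc n))) \<longlonglongrightarrow> m + 0"
    by (intro tendsto_intros LIMSEQ_inverse_real_of_nat)
  ultimately have "\<Phi> z \<le> m + 0"
    by (rule LIMSEQ_le) (use X in \<open>auto intro: less_imp_le\<close>)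
  then have min: "\<Phi> z \<le> \<Phi> x" for x
    using m_le[of x] by simp
  have "\<phi> v = inner v z" for v
  proof (cases "v = 0")
    case False
    \<comment> \<open>\<open>a\<close> is half the derivative of \<open>\<Phi>\<close> at
      \<open>z\<close> along \<open>v\<close>, and \<open>t\<close> minimises the quadratic
      \<open>2 * t * a + t^2 * (norm v)^2\<close>; its minimum is negative unless
      \<open>a = 0\<close>.\<close>
    define a where "a = inner v z - \<phi> v"
    define t where "t = - a / (norm v)\<^sup>2"
    have t: "t * (norm v)\<^sup>2 = - a"
      using False by (simp add: t_def)
    have "\<Phi> (z + t *\<^sub>R v) - \<Phi> z = 2 * t * a + t * (t * (norm v)\<^sup>2)"
      unfolding \<Phi>_def a_def
      by (simp add: power2_norm_eq_inner scaleR add algebra_simps inner_commute)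
    also have "\<dots> = - (a\<^sup>2 / (norm v)\<^sup>2)"
      unfolding t by (simp add: t_def power2_eq_square)
    finally have "a\<^sup>2 / (norm v)\<^sup>2 \<le> 0"
      using min[of "z + t *\<^sub>R v"] by linarith
    then have "a = 0"
      using False by (simp add: divide_le_0_iff)
    then show ?thesis by (simp add: a_def)
  qed (simp add: zero)
  then show thesis by (rule that)
qed

lemma scaleR_scaleC: "r *\<^sub>R x = complex_of_real r *\<^sub>C x"
  for x :: "'a::complex_inner"
  by (simp add: scaleC_of_real)

lemma Im_cinner: "Im (cinner x y) = - inner (\<i> *\<^sub>C x) y"
  using Re_cinner[of "\<i> *\<^sub>C x" y] by (simp add: cinner_scaleC_left)

text \<open>Testing against \<open>y - z\<close> suffices. This supplies uniqueness for the definite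
  descriptions that define adjoints.\<close>

lemma cinner_eqI:
  assumes "\<And>x. cinner x y = cinner x z"
  shows "y = z"
proof -
  have "inner (y - z) y = inner (y - z) z"
    using assms[of "y - z"] by (metis Re_cinner)
  then have "inner (y - z) (y - z) = 0"
    by (simp only: inner_diff_right)
  then show ?thesis by simp
qed

text \<open>Real and imaginary parts are each bounded by the real Cauchy-Schwarz inequality, which
  produces the factor 2; multiplication by \<open>\<i>\<close> is isometric.\<close>

lemma norm_cinner_le: "norm (cinner x y) \<le> 2 * (norm x * norm y)"
proof -
  have "(norm (\<i> *\<^sub>C x))\<^sup>2 = (norm x)\<^sup>2"
  proof -
    have "cinner (\<i> *\<^sub>C x) (\<i> *\<^sub>C x) = \<i> * cnj (cinner (\<i> *\<^sub>C x) x)"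
      by (metis cinner_scaleC_left cinner_commute)
    also have "\<dots> = cinner x x"
      by (simp add: cinner_scaleC_left cinner_self)
    finally have "cinner (\<i> *\<^sub>C x) (\<i> *\<^sub>C x) = cinner x x" .
    then show ?thesis
      by (metis cinner_self of_real_eq_iff)
  qed
  then have "norm (\<i> *\<^sub>C x) = norm x"
    by simp
  then have "\<bar>Re (cinner x y)\<bar> \<le> norm x * norm y" "\<bar>Im (cinner x y)\<bar> \<le> norm x * norm y"
    using Cauchy_Schwarz_ineq2[of x y] Cauchy_Schwarz_ineq2[of "\<i> *\<^sub>C x" y]
    by (simp_all add: Re_cinner Im_cinner)
  then show ?thesis
    using cmod_le[of "cinner x y"] by linarith
qed

text \<open>The real Riesz vector of \<open>Re h\<close> represents all of \<open>h\<close>, since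
  evaluating at \<open>\<i> *\<^sub>C x\<close> recovers the imaginary part.\<close>

lemma complex_riesz:
  fixes h :: "'a::complex_hilbert \<Rightarrow> complex"
  assumes add: "\<And>x y. h (x + y) = h x + h y"
    and scale: "\<And>c x. h (c *\<^sub>C x) = c * h x"
    and bound: "\<And>x. norm (h x) \<le> norm x * M"
  shows "\<exists>!z. \<forall>x. h x = cinner x z"
proof (rule ex_ex1I)
  have "bounded_linear (\<lambda>x. Re (h x))"
  proof (rule bounded_linear_intro)
    show "norm (Re (h x)) \<le> norm x * M" for x
      using bound[of x] abs_Re_le_cmod[of "h x"] by simp
  qed (simp_all add: add scale scaleR_scaleC)
  then obtain z where z: "\<And>x. Re (h x) = inner x z"
    using real_riesz by blast
  have "h x = cinner x z" for x
    using z[of x] z[of "\<i> *\<^sub>C x"]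
    by (intro complex_eqI) (simp_all add: scale Re_cinner Im_cinner)
  then show "\<exists>z. \<forall>x. h x = cinner x z" by blast
  show "y = z" if "\<forall>x. h x = cinner x y" "\<forall>x. h x = cinner x z" for y z
    using that by (metis cinner_eqI)
qed

lemma cinner_cadjoint:
  fixes T :: "'a::complex_hilbert \<Rightarrow> 'b::complex_inner"
  assumes "bounded_clinear T"
  shows "cinner (T x) y = cinner x (cadjoint T y)"
proof -
  from assms interpret bounded_linear T by (simp add: bounded_clinear_def)
  obtain M where M: "\<And>x. norm (T x) \<le> norm x * M"
    using bounded by blast
  have "\<exists>!z. \<forall>x. cinner (T x) y = cinner x z"
  proof (rule complex_riesz)
    show "norm (cinner (T x) y) \<le> norm x * (2 * M * norm y)" for x
      using norm_cinner_le[of "T x" y] mult_right_mono[OF M[of x], of "norm y"]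
      by (simp add: ac_simps)
  qed (use assms in \<open>simp_all add: add cinner_add_left bounded_clinear_def cinner_scaleC_left\<close>)
  from theI'[OF this] show ?thesis
    unfolding cadjoint_def by blast
qed

section \<open>The Hilbert-Schmidt inner product and adjoints with respect to it\<close>

lemma hs_inner_eq:
  fixes T S :: "'k::complex_hilbert \<Rightarrow> 'k"
  assumes "hilbert_schmidt S"
  shows "hs_inner T S = (\<Sum>\<^sub>\<infinity>e\<in>some_onb. cinner (T e) (S e))"
proof -
  \<comment> \<open>Conjugating the adjoint relation moves \<open>S\<close> to the second slot of
    every diagonal term of the trace.\<close>
  have "cinner (cadjoint S y) x = cinner y (S x)" for x y
    using cinner_cadjoint[of S x y] assms cinner_commute
    by (metis hilbert_schmidt_def)
  then show ?thesis
    by (simp add: hs_inner_def trace_op_def)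
qed

lemma norm_cinner_le_squares: "norm (cinner x y) \<le> (norm x)\<^sup>2 + (norm y)\<^sup>2"
  using norm_cinner_le[of x y] sum_squares_bound[of "norm x" "norm y"] by simp

lemma hs_abs_summable:
  assumes "hilbert_schmidt T" "hilbert_schmidt S"
  shows "(\<lambda>e. norm (cinner (T e) (S e))) summable_on some_onb"
proof (rule Infinite_Sum.abs_summable_on_comparison_test')
  show "(\<lambda>e. (norm (T e))\<^sup>2 + (norm (S e))\<^sup>2) summable_on some_onb"
    using assms by (intro summable_on_add) (simp_all add: hilbert_schmidt_def)
qed (rule norm_cinner_le_squares)

lemmas hs_summable = abs_summable_summable[OF hs_abs_summable]

lemma hs_norm_power2:
  fixes T :: "'k::complex_hilbert \<Rightarrow> 'k"
  assumes "hilbert_schmidt T"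
  shows "(hs_norm T)\<^sup>2 = Re (hs_inner T T)"
    and "(hs_norm T)\<^sup>2 = (\<Sum>\<^sub>\<infinity>e\<in>some_onb. (norm (T e))\<^sup>2)"
proof -
  have "Re (hs_inner T T) = (\<Sum>\<^sub>\<infinity>e\<in>some_onb. (norm (T e))\<^sup>2)"
    using infsum_Re[OF hs_summable[OF assms assms]]
    by (simp add: hs_inner_eq[OF assms] cinner_self)
  moreover have "\<dots> \<ge> 0"
    by (intro infsum_nonneg) simp
  ultimately show "(hs_norm T)\<^sup>2 = Re (hs_inner T T)"
    "(hs_norm T)\<^sup>2 = (\<Sum>\<^sub>\<infinity>e\<in>some_onb. (norm (T e))\<^sup>2)"
    by (simp_all add: hs_norm_def)
qed

text \<open>A termwise substitute for Cauchy-Schwarz. It is not homogeneous, so it becomes a linear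
  bound only after normalising the argument.\<close>

lemma norm_hs_inner_le:
  fixes T S :: "'k::complex_hilbert \<Rightarrow> 'k"
  assumes T: "hilbert_schmidt T" and S: "hilbert_schmidt S"
  shows "norm (hs_inner T S) \<le> (hs_norm T)\<^sup>2 + (hs_norm S)\<^sup>2"
proof -
  have sq: "(\<lambda>e. (norm (T e))\<^sup>2) summable_on some_onb" "(\<lambda>e. (norm (S e))\<^sup>2) summable_on some_onb"
    using assms by (simp_all add: hilbert_schmidt_def)
  have "norm (hs_inner T S) \<le> (\<Sum>\<^sub>\<infinity>e\<in>some_onb. norm (cinner (T e) (S e)))"
    unfolding hs_inner_eq[OF S] by (intro norm_infsum_bound hs_abs_summable T S)
  also have "\<dots> \<le> (\<Sum>\<^sub>\<infinity>e\<in>some_onb. (norm (T e))\<^sup>2 + (norm (S e))\<^sup>2)"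
    by (intro infsum_mono hs_abs_summable T S summable_on_add sq norm_cinner_le_squares)
  also have "\<dots> = (hs_norm T)\<^sup>2 + (hs_norm S)\<^sup>2"
    by (simp add: infsum_add sq hs_norm_power2(2) T S)
  finally show ?thesis .
qed

lemma hs_inner_commute:
  fixes T S :: "'k::complex_hilbert \<Rightarrow> 'k"
  assumes "hilbert_schmidt T" "hilbert_schmidt S"
  shows "hs_inner T S = cnj (hs_inner S T)"
  unfolding hs_inner_eq[OF assms(1)] hs_inner_eq[OF assms(2)]
  by (subst infsum_cnj[symmetric]) (simp add: cinner_commute[symmetric])

text \<open>Shows that the description in \<open>hs_adjoint\<close> denotes:
  \<open>f \<mapsto> hs_inner (G f) T\<close> is a bounded functional, so
  \<open>complex_riesz\<close> applies.\<close>

lemma hs_inner_hs_adjoint: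
  fixes G :: "'h::complex_hilbert \<Rightarrow> 'k::complex_hilbert \<Rightarrow> 'k"
  assumes G: "bounded_hs_map G" and T: "hilbert_schmidt T"
  shows "hs_inner (G f) T = cinner f (hs_adjoint G T)"
proof -
  from G have hs: "hilbert_schmidt (G f)" for f by (simp add: bounded_hs_map_def)
  from G have Gadd: "G (f + g) = (\<lambda>x. G f x + G g x)" for f g by (simp add: bounded_hs_map_def)
  from G have Gscale: "G (c *\<^sub>C f) = (\<lambda>x. c *\<^sub>C G f x)" for c f by (simp add: bounded_hs_map_def)
  from G obtain M where M: "hs_norm (G f) \<le> M * norm f" for f by (auto simp: bounded_hs_map_def)
  define h where "h f = hs_inner (G f) T" for f
  have add: "h (f + g) = h f + h g" for f g
    by (simp add: h_def hs_inner_eq[OF T] Gadd cinner_add_left infsum_add hs_summable hs T)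
  have scale: "h (c *\<^sub>C f) = c * h f" for c f
    by (simp add: h_def hs_inner_eq[OF T] Gscale cinner_scaleC_left infsum_cmult_right'
        del: infsum_cmult_right)
  have bound: "norm (h f) \<le> norm f * (M\<^sup>2 + (hs_norm T)\<^sup>2)" for f
  proof (cases "f = 0")
    case True
    have "h 0 = 0" using add[of 0 0] by simp
    with True show ?thesis by simp
  next
    case False
    \<comment> \<open>The sum-of-squares bound is used at the unit vector \<open>u\<close> only;
      homogeneity of \<open>h\<close> carries it back to \<open>f\<close>.\<close>
    define u where "u = complex_of_real (1 / norm f) *\<^sub>C f"
    have u: "norm u = 1"
      using False by (simp add: u_def scaleC_of_real del: of_real_divide)
    have f: "f = complex_of_real (norm f) *\<^sub>C u"
      using False by (simp add: u_def scaleC_of_real del: of_real_divide)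
    have "0 \<le> hs_norm (G u)"
      unfolding hs_norm_def using hs_norm_power2(1)[OF hs[of u]] by (metis real_sqrt_ge_zero zero_le_power2)
    then have "(hs_norm (G u))\<^sup>2 \<le> M\<^sup>2"
      using M[of u] u by (intro power_mono) simp_all
    then have "norm (h u) \<le> M\<^sup>2 + (hs_norm T)\<^sup>2"
      using norm_hs_inner_le[OF hs[of u] T] by (simp add: h_def)
    moreover have "norm (h f) = norm f * norm (h u)"
      by (subst f) (simp add: scale norm_mult)
    ultimately show ?thesis
      by (simp add: mult_left_mono)
  qed
  have "\<exists>!z. \<forall>f. h f = cinner f z"
    using add scale bound by (rule complex_riesz)
  from theI'[OF this] show ?thesis
    unfolding hs_adjoint_def h_def by blast
qed

section \<open>From weak to unconditional norm convergence\<close>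

text \<open>
  For a finite partial sum \<open>P\<close> of the \<open>S\<^sub>j\<close> both \<open>P\<close> and \<open>R = I - P\<close> are positive;
  positivity of \<open>R\<close> at \<open>f - R f\<close> gives \<open>\<parallel>R f\<parallel>\<^sup>2 \<le> \<langle>f, R f\<rangle>\<close>, so weak convergence becomes
  norm convergence.
\<close>

lemma positive_resolution_has_sum:
  fixes S :: "'j \<Rightarrow> 'h::real_inner \<Rightarrow> 'h"
  assumes sym: "\<And>j f g. j \<in> J \<Longrightarrow> inner f (S j g) = inner g (S j f)"
    and pos: "\<And>j f. j \<in> J \<Longrightarrow> 0 \<le> inner f (S j f)"
    and resolution: "\<And>f. ((\<lambda>j. inner f (S j f)) has_sum (norm f)\<^sup>2) J"
  shows "((\<lambda>j. S j f) has_sum f) J"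
proof -
  define q where "q F f = (\<Sum>j\<in>F. inner f (S j f))" for F f
  have q_le: "q F f \<le> (norm f)\<^sup>2" and q_ge: "0 \<le> q F f" if "finite F" "F \<subseteq> J" for F f
    using finite_sum_le_has_sum[OF resolution that] pos that
    by (auto simp: q_def intro!: sum_nonneg)
  have bound: "(norm (f - (\<Sum>j\<in>F. S j f)))\<^sup>2 \<le> (norm f)\<^sup>2 - q F f" if F: "finite F" "F \<subseteq> J" for F
  proof -
    define g where "g = f - (\<Sum>j\<in>F. S j f)"
    \<comment> \<open>Symmetry yields additivity of \<open>S j\<close>: moved onto \<open>x\<close>,
      it leaves \<open>f - g\<close> in a linear slot.\<close>
    have S_diff: "inner x (S j (f - g)) = inner x (S j f) - inner x (S j g)" if "j \<in> J" for j x
      using sym[OF that] by (metis inner_diff_left)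
    have "q F (f - g) = (\<Sum>j\<in>F. inner f (S j f) + inner g (S j g) - 2 * inner g (S j f))"
      unfolding q_def
    proof (rule sum.cong)
      fix j assume "j \<in> F"
      then have "j \<in> J" using F by blast
      then show "inner (f - g) (S j (f - g)) =
          inner f (S j f) + inner g (S j g) - 2 * inner g (S j f)"
        using sym[of j f g] by (simp add: inner_diff_left S_diff)
    qed simp
    also have "\<dots> = q F f + q F g - 2 * inner g (f - g)"
      by (simp add: q_def g_def sum.distrib sum_subtractf inner_sum_right flip: sum_distrib_left)
    \<comment> \<open>This is positivity of the remainder at \<open>f - g\<close>. The cross terms
      cancel against those of \<open>(norm (f - g))^2\<close> below, and \<open>q F g\<close> is
      dropped by positivity.\<close>
    finally have "q F f + q F g - 2 * inner g (f - g) \<le> (norm (f - g))\<^sup>2"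
      using q_le[OF F, of "f - g"] by simp
    moreover have "(norm (f - g))\<^sup>2 = (norm f)\<^sup>2 - (norm g)\<^sup>2 - 2 * inner g (f - g)"
      by (simp add: power2_norm_eq_inner inner_diff_left inner_diff_right inner_commute)
    ultimately show ?thesis
      using q_ge[OF F, of g] unfolding g_def by linarith
  qed
  \<comment> \<open>The bound on the squared error is the remainder of a convergent real series, so
    a squeeze along finite subsets applies after taking roots.\<close>
  have "((\<lambda>F. (norm f)\<^sup>2 - q F f) \<longlongrightarrow> (norm f)\<^sup>2 - (norm f)\<^sup>2) (finite_subsets_at_top J)"
    using resolution[of f] unfolding has_sum_def q_def by (intro tendsto_intros)
  then have "((\<lambda>F. sqrt ((norm f)\<^sup>2 - q F f)) \<longlongrightarrow> 0) (finite_subsets_at_top J)"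
    using tendsto_real_sqrt by fastforce
  then have "((\<lambda>F. f - (\<Sum>j\<in>F. S j f)) \<longlongrightarrow> 0) (finite_subsets_at_top J)"
  proof (rule Lim_null_comparison[rotated])
    show "\<forall>\<^sub>F F in finite_subsets_at_top J.
        norm (f - (\<Sum>j\<in>F. S j f)) \<le> sqrt ((norm f)\<^sup>2 - q F f)"
      by (rule eventually_finite_subsets_at_top_weakI) (use bound real_le_rsqrt in blast)
  qed
  from tendsto_diff[OF tendsto_const[of f] this] show ?thesis
    unfolding has_sum_def by simp
qed

section \<open>The identity for complementary subsums\<close>

lemma parseval_identity_complement:
  fixes s :: "'j \<Rightarrow> 'h::{real_inner,complete_space}"
  assumes sum: "(s has_sum f) J" and K: "K \<subseteq> J"
  shows "s summable_on K"
    and "s summable_on (J - K)"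
    and "(\<Sum>\<^sub>\<infinity>j\<in>K. inner f (s j)) - (norm (\<Sum>\<^sub>\<infinity>j\<in>K. s j))\<^sup>2 =
      (\<Sum>\<^sub>\<infinity>j\<in>J - K. inner f (s j)) - (norm (\<Sum>\<^sub>\<infinity>j\<in>J - K. s j))\<^sup>2"
proof -
  \<comment> \<open>In a complete space every subfamily of an unconditionally summable family is
    summable.\<close>
  have summable: "s summable_on L" if "L \<subseteq> J" for L
    using complete_UNIV isUCont_plus has_sum_imp_summable[OF sum] that
    by (rule summable_on_subset_aux)
  define u v where "u = (\<Sum>\<^sub>\<infinity>j\<in>K. s j)" and "v = (\<Sum>\<^sub>\<infinity>j\<in>J - K. s j)"
  have u: "(s has_sum u) K" and v: "(s has_sum v) (J - K)"
    unfolding u_def v_def using K by (auto intro!: has_sum_infsum summable)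
  have "(s has_sum (u + v)) (K \<union> (J - K))"
    by (rule has_sum_Un_disjoint[OF u v]) simp
  with K have "(s has_sum (u + v)) J"
    by (simp add: Un_absorb1)
  with sum have f: "f = u + v"
    by (rule has_sum_unique)
  have "(\<Sum>\<^sub>\<infinity>j\<in>K. inner f (s j)) = inner f u"
    "(\<Sum>\<^sub>\<infinity>j\<in>J - K. inner f (s j)) = inner f v"
    by (intro infsumI has_sum_bounded_linear[OF bounded_linear_inner_right] u v)+
  \<comment> \<open>Substituting \<open>f = u + v\<close> reduces both sides to
    \<open>inner u v\<close>.\<close>
  moreover have "inner f u - (norm u)\<^sup>2 = inner f v - (norm v)\<^sup>2"
    by (simp add: f power2_norm_eq_inner inner_add_left inner_add_right inner_commute)
  ultimately show "(\<Sum>\<^sub>\<infinity>j\<in>K. inner f (s j)) - (norm (\<Sum>\<^sub>\<infinity>j\<in>K. s j))\<^sup>2 =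
      (\<Sum>\<^sub>\<infinity>j\<in>J - K. inner f (s j)) - (norm (\<Sum>\<^sub>\<infinity>j\<in>J - K. s j))\<^sup>2"
    by (simp add: u_def v_def)
  show "s summable_on K" "s summable_on (J - K)"
    using K by (auto intro: summable)
qed

text \<open>The summability conjuncts ensure that the vector sums are genuine limits, as
  \<open>infsum\<close> defaults to 0 on families that are not summable.\<close>

theorem theorem3p2:
  fixes J :: "'j set"
    and G :: "'j \<Rightarrow> 'h::complex_hilbert \<Rightarrow> 'k::complex_hilbert \<Rightarrow> 'k"
  assumes "countable J"
    and "parseval_hs_frame J G"
  shows "\<forall>K \<subseteq> J. \<forall>f.
    (\<lambda>j. hs_adjoint (G j) (G j f)) summable_on K \<and>
    (\<lambda>j. hs_adjoint (G j) (G j f)) summable_on (J - K) \<and>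
    (\<Sum>\<^sub>\<infinity>j\<in>K. (hs_norm (G j f))\<^sup>2) - (norm (\<Sum>\<^sub>\<infinity>j\<in>K. hs_adjoint (G j) (G j f)))\<^sup>2 =
    (\<Sum>\<^sub>\<infinity>j\<in>J - K. (hs_norm (G j f))\<^sup>2) - (norm (\<Sum>\<^sub>\<infinity>j\<in>J - K. hs_adjoint (G j) (G j f)))\<^sup>2"
proof (intro allI impI)
  fix K f assume K: "K \<subseteq> J"
  define S where "S j f = hs_adjoint (G j) (G j f)" for j f
  have G: "bounded_hs_map (G j)" if "j \<in> J" for j
    using assms(2) that by (simp add: parseval_hs_frame_def hs_frame_with_bounds_def)
  then have hs: "hilbert_schmidt (G j f)" if "j \<in> J" for j f
    using that by (simp add: bounded_hs_map_def)
  \<comment> \<open>Taking real parts of the adjoint relation passes to the real inner product,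
    which is enough for an identity between norms.\<close>
  have inner_S: "inner g (S j f) = Re (hs_inner (G j g) (G j f))" if "j \<in> J" for j f g
    using hs_inner_hs_adjoint[OF G hs] that by (simp add: S_def Re_cinner)
  have hs_norm_S: "(hs_norm (G j f))\<^sup>2 = inner f (S j f)" if "j \<in> J" for j f
    using that by (simp add: inner_S hs hs_norm_power2(1))
  have sum: "((\<lambda>j. S j f) has_sum f) J"
  proof (rule positive_resolution_has_sum)
    show "inner f (S j g) = inner g (S j f)" if "j \<in> J" for j f g
      using hs_inner_commute[OF hs hs, OF that that] by (metis cnj.sel(1) inner_S that)
    show "0 \<le> inner f (S j f)" if "j \<in> J" for j f
      using that by (simp flip: hs_norm_S)
    show "((\<lambda>j. inner f (S j f)) has_sum (norm f)\<^sup>2) J" for f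
    proof -
      \<comment> \<open>Both frame bounds equal 1, so the two inequalities pinch the sum to
        \<open>(norm f)^2\<close>.\<close>
      have "(\<lambda>j. (hs_norm (G j f))\<^sup>2) summable_on J"
        "(\<Sum>\<^sub>\<infinity>j\<in>J. (hs_norm (G j f))\<^sup>2) = (norm f)\<^sup>2"
        using assms(2) unfolding parseval_hs_frame_def hs_frame_with_bounds_def
        by (auto intro: antisym)
      then have "((\<lambda>j. (hs_norm (G j f))\<^sup>2) has_sum (norm f)\<^sup>2) J"
        by (metis has_sum_infsum)
      then show ?thesis
        by (simp add: hs_norm_S cong: has_sum_cong)
    qed
  qed
  have norms: "(\<Sum>\<^sub>\<infinity>j\<in>L. (hs_norm (G j f))\<^sup>2) = (\<Sum>\<^sub>\<infinity>j\<in>L. inner f (S j f))" if "L \<subseteq> J" for L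
    using that by (intro infsum_cong hs_norm_S) blast
  show "(\<lambda>j. hs_adjoint (G j) (G j f)) summable_on K \<and>
    (\<lambda>j. hs_adjoint (G j) (G j f)) summable_on (J - K) \<and>
    (\<Sum>\<^sub>\<infinity>j\<in>K. (hs_norm (G j f))\<^sup>2) - (norm (\<Sum>\<^sub>\<infinity>j\<in>K. hs_adjoint (G j) (G j f)))\<^sup>2 =
    (\<Sum>\<^sub>\<infinity>j\<in>J - K. (hs_norm (G j f))\<^sup>2) - (norm (\<Sum>\<^sub>\<infinity>j\<in>J - K. hs_adjoint (G j) (G j f)))\<^sup>2"
    using parseval_identity_complement[OF sum K]
    unfolding norms[OF K] norms[OF Diff_subset] unfolding S_def by blast
qed

end
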